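(* Let $n\ge 1$ and $k\ge 1$ be integers, let $\mathbb{S}^n\subset\mathbb{R}^{n+1}$ be the unit sphere with a base point $s_0\in\mathbb{S}^n$, let $\Omega\mathbb{S}^n=\{\alpha:[0,1]\to\mathbb{S}^n \text{ continuous} : \alpha(0)=\alpha(1)=s_0\}$ (with the compact-open topology), let $\alpha^\star(t):=\alpha(1-t)$, and let $\Omega_{\mathrm{tf}}=\{\alpha\in\Omega\mathbb{S}^n:\alpha=\alpha^\star\}$. For a continuous map $f:\Omega\mathbb{S}^n\setminus\Omega_{\mathrm{tf}}\to\mathbb{R}^k$ put $A_f=\{\alpha\in\Omega\mathbb{S}^n\setminus\Omega_{\mathrm{tf}} : f(\alpha)=f(\alpha^\star)\}$. Then: (A) if $k<n$, then for every continuous $f:\Omega\mathbb{S}^n\setminus\Omega_{\mathrm{tf}}\to\mathbb{R}^k$ one has $\dim A_f=\infty$; (B) if $k=n$, then for every continuous $f:\Omega\mathbb{S}^n\setminus\Omega_{\mathrm{tf}}\to\mathbb{R}^k$ one has $A_f\neq\emptyset$.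
   Context: The group $\mathbb{Z}_2$ acts on $\Omega\mathbb{S}^n$ by $\alpha\mapsto\alpha^\star$ (loop reversal); $\Omega_{\mathrm{tf}}$ ("to and fro" loops) is its fixed point set. *)

theory Defs
  imports "HOL-Analysis.Analysis"
begin

text \<open>Based loop space of the unit sphere. A loop is represented as a function on all of
  the reals which is continuous on [0,1], maps [0,1] into the unit sphere, sends 0 and 1 to
  the base point, and is constantly equal to the base point outside [0,1] (a canonical
  extension, so that loops are determined by their values on [0,1]).\<close>
definition loops :: "'a::euclidean_space \<Rightarrow> (real \<Rightarrow> 'a) set" where
  "loops s0 = {\<alpha>. continuous_on {0..1} \<alpha> \<and> \<alpha> ` {0..1} \<subseteq> sphere 0 1
               \<and> \<alpha> 0 = s0 \<and> \<alpha> 1 = s0 \<and> (\<forall>t. t \<notin> {0..1} \<longrightarrow> \<alpha> t = s0)}"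

definition rev_loop :: "(real \<Rightarrow> 'a) \<Rightarrow> (real \<Rightarrow> 'a)" where
  "rev_loop \<alpha> = (\<lambda>t. \<alpha> (1 - t))"

definition tf_loops :: "'a::euclidean_space \<Rightarrow> (real \<Rightarrow> 'a) set" where
  "tf_loops s0 = {\<alpha> \<in> loops s0. \<alpha> = rev_loop \<alpha>}"

definition loop_top :: "'a::euclidean_space \<Rightarrow> (real \<Rightarrow> 'a) topology" where
  "loop_top s0 = topology_generated_by
     {{\<alpha> \<in> loops s0. \<alpha> ` K \<subseteq> U} | K U.
        compact K \<and> K \<subseteq> {0..1} \<and> openin (top_of_set (sphere (0::'a) 1)) U}"

definition covering_dim_le :: "'a topology \<Rightarrow> nat \<Rightarrow> bool" where
  "covering_dim_le X m \<longleftrightarrow>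
     (\<forall>\<U>. finite \<U> \<and> (\<forall>U\<in>\<U>. openin X U) \<and> \<Union>\<U> = topspace X \<longrightarrow>
        (\<exists>\<V>. finite \<V> \<and> (\<forall>V\<in>\<V>. openin X V) \<and> \<Union>\<V> = topspace X
             \<and> (\<forall>V\<in>\<V>. \<exists>U\<in>\<U>. V \<subseteq> U)
             \<and> (\<forall>x\<in>topspace X. card {V\<in>\<V>. x \<in> V} \<le> m + 1)))"

definition infinite_dim :: "'a topology \<Rightarrow> bool" where
  "infinite_dim X \<longleftrightarrow> (\<forall>m. \<not> covering_dim_le X m)"

definition coincidence_set ::
  "'a::euclidean_space \<Rightarrow> ((real \<Rightarrow> 'a) \<Rightarrow> 'b) \<Rightarrow> (real \<Rightarrow> 'a) set" where
  "coincidence_set s0 f = {\<alpha> \<in> loops s0 - tf_loops s0. f \<alpha> = f (rev_loop \<alpha>)}"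

end

theory Submission
  imports Defs "HOL-Homology.Homology" "HOL-Computational_Algebra.Polynomial"
begin

text \<open>Loops in a great circle through the base point, with odd angle functions, embed spheres of every
  dimension \<open>N\<close> into the loop space, equivariantly for the antipodal map and loop reversal and off
  the fixed points. On such a sphere, the coincidence set of \<open>f\<close> is the zero set \<open>Z\<close> of an odd map
  to a \<open>k\<close>-dimensional space. If the coincidence set had covering dimension at most \<open>d\<close>, then a
  fine enough finite cover of order \<open>d + 1\<close>, none of whose members meets its own antipode, would yield
  odd functions on the sphere, at most \<open>2 * (d + 1)\<close> of them nonzero at each point of \<open>Z\<close> and not
  all zero there. By a Vandermonde argument \<open>2 * (d + 1)\<close> linear combinations of them have no common
  zero on \<open>Z\<close>, contradicting the Borsuk-Ulam theorem for \<open>N = k + 2 * (d + 1)\<close>. So the coincidence set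
  is infinite-dimensional for every \<open>k\<close>, and in particular nonempty.\<close>

section \<open>The Borsuk-Ulam theorem\<close>

definition generated_by :: "('a, 'b) monoid_scheme \<Rightarrow> 'a \<Rightarrow> bool"
  where "generated_by G a \<longleftrightarrow> a \<in> carrier G \<and> (\<forall>x\<in>carrier G. \<exists>k::int. x = a [^]\<^bsub>G\<^esub> k)"

text \<open>Lets a generator travel through the hemisphere isomorphisms below, in either
  direction.\<close>

lemma generated_by_iso_iff:
  assumes f: "f \<in> iso G H" and "group G" "group H" and a: "a \<in> carrier G"
  shows "generated_by H (f a) \<longleftrightarrow> generated_by G a"
proof -
  interpret group_hom G H f
    using assms by (simp add: group_hom_def group_hom_axioms_def iso_imp_homomorphism)
  have inj: "inj_on f (carrier G)" and surj: "f ` carrier G = carrier H"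
    using f by (auto simp: iso_def bij_betw_def)
  have "(\<exists>k::int. x = a [^]\<^bsub>G\<^esub> k) \<longleftrightarrow> (\<exists>k::int. f x = f a [^]\<^bsub>H\<^esub> k)" if "x \<in> carrier G" for x
    using inj that a by (metis G.int_pow_closed hom_int_pow inj_on_def)
  then have "(\<forall>x\<in>carrier G. \<exists>k::int. x = a [^]\<^bsub>G\<^esub> k)
      \<longleftrightarrow> (\<forall>y\<in>f ` carrier G. \<exists>k::int. y = f a [^]\<^bsub>H\<^esub> k)"
    by simp
  then show ?thesis
    using a by (simp add: generated_by_def surj)
qed

text \<open>Powers in the quotient of relative cycles by boundaries are computed on representatives,
  and there they are multiples of chains.\<close>

lemma homologous_rel_set_cmul:
  assumes c: "singular_relcycle p X S c"
  shows "homologous_rel_set p X S (frag_cmul k c)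
       = homologous_rel_set p X S c [^]\<^bsub>relative_homology_group (int p) X S\<^esub> (k::int)"
proof -
  have cc: "c \<in> carrier (relcycle_group p X S)"
    using c by simp
  have "c [^]\<^bsub>relcycle_group p X S\<^esub> k = c [^]\<^bsub>chain_group p X\<^esub> k"
    using cc unfolding relcycle_group_def by (simp add: group.int_pow_subgroup_generated)
  also have "\<dots> = frag_cmul k c"
    using c by (simp add: chain_group_def singular_relcycle singular_chain_def)
  finally have ff: "c [^]\<^bsub>relcycle_group p X S\<^esub> k = frag_cmul k c" .
  show ?thesis
    apply (rule subst [OF right_coset_singular_relboundary])
    by (simp add: ff normal.FactGroup_int_pow normal_subgroup_singular_relboundary_relcycle 
        relative_homology_group_def c)
qed

section \<open>The antipodal map on spheres and on singular chains\<close>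

definition antipode :: "(nat \<Rightarrow> real) \<Rightarrow> nat \<Rightarrow> real"
  where "antipode x = (\<lambda>i. - x i)"

lemma antipode_antipode [simp]: "antipode (antipode x) = x"
  by (simp add: antipode_def)

lemma continuous_map_nsphere_antipode: "continuous_map (nsphere n) (nsphere n) antipode"
proof -
  have "\<And>k. continuous_map (powertop_real UNIV) euclideanreal (\<lambda>x. - x k)"
    by (metis UNIV_I continuous_map_product_projection continuous_map_minus)
  then show ?thesis
    by (force simp: nsphere continuous_map_in_subtopology antipode_def continuous_map_componentwise_UNIV
        intro: continuous_map_from_subtopology)
qed

text \<open>Writing T for the involution of chains induced by the antipode, this is the operator T +
  s; only s = 1 and s = -1 occur.\<close>

definition antipodal_sum :: "nat \<Rightarrow> int \<Rightarrow> (nat \<Rightarrow> real) chain \<Rightarrow> (nat \<Rightarrow> real) chain"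
  where "antipodal_sum p s c = chain_map p antipode c + frag_cmul s c"

lemma antipodal_sum_diff: "antipodal_sum p s (a - b) = antipodal_sum p s a - antipodal_sum p s b"
  by (rule poly_mapping_eqI) (simp add: antipodal_sum_def chain_map_diff lookup_add lookup_minus algebra_simps)

lemma antipodal_sum_cmul: "antipodal_sum p s (frag_cmul k c) = frag_cmul k (antipodal_sum p s c)"
  by (simp add: antipodal_sum_def frag_cmul_distrib2 mult.commute)

lemma singular_chain_antipodal_sum:
  "singular_chain p (nsphere n) c \<Longrightarrow> singular_chain p (nsphere n) (antipodal_sum p s c)"
  unfolding antipodal_sum_def
  by (intro singular_chain_add singular_chain_cmul singular_chain_chain_map [OF _ continuous_map_nsphere_antipode])

lemma chain_map_antipode_antipode:
  assumes "singular_chain p X c"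
  shows "chain_map p antipode (chain_map p antipode c) = c"
proof -
  have "chain_map p (antipode \<circ> antipode) c = c"
    by (rule chain_map_id_gen [OF assms]) simp
  then show ?thesis
    by (simp add: chain_map_compose)
qed

lemma chain_boundary_antipodal_sum:
  "singular_chain (Suc p) X c \<Longrightarrow>
   chain_boundary (Suc p) (antipodal_sum (Suc p) s c) = antipodal_sum p s (chain_boundary (Suc p) c)"
  by (simp add: antipodal_sum_def chain_boundary_add chain_boundary_cmul chain_boundary_chain_map)

text \<open>This is (T - s) (T + s) = T^2 - s^2 = 0.\<close>

lemma antipodal_sum_antipodal_sum_minus:
  assumes c: "singular_chain p X c" and s: "s * s = 1"
  shows "antipodal_sum p (- s) (antipodal_sum p s c) = 0"
proof -
  have "s = 1 \<or> s = -1"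
    using s by (simp add: square_eq_1_iff)
  then show ?thesis
    by (auto simp: antipodal_sum_def chain_map_add chain_map_minus chain_map_antipode_antipode [OF c])
qed

text \<open>From T^2 = s^2 = 1 follows (T + s)^2 = 2 + 2 s T = 2 s (T + s). The factor 2 is the
  source of the parity argument.\<close>

lemma antipodal_sum_antipodal_sum:
  assumes c: "singular_chain p X c" and s: "s * s = 1"
  shows "antipodal_sum p s (antipodal_sum p s c) = frag_cmul (2 * s) (antipodal_sum p s c)"
proof -
  have "s = 1 \<or> s = -1"
    using s by (simp add: square_eq_1_iff)
  then show ?thesis
    by (auto intro!: poly_mapping_eqI simp: antipodal_sum_def chain_map_add chain_map_minus 
       chain_map_antipode_antipode [OF c] lookup_add lookup_minus)
qed

text \<open>The chains of such a tower model the hemispheres of the standard antipodally symmetric cell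
  structure of a sphere. The alternating sign makes consecutive antipodal sums cancel, as
  \<open>(T + s) (T - s) = 0\<close> for the antipodal involution \<open>T\<close> and \<open>s = \<plusminus>1\<close>.\<close>
definition antipodal_tower :: "(nat \<Rightarrow> real) topology \<Rightarrow> nat \<Rightarrow> (nat \<Rightarrow> (nat \<Rightarrow> real) chain) \<Rightarrow> bool"
  where "antipodal_tower X N e \<longleftrightarrow>
    (\<exists>f. e 0 = frag_of f) \<and> (\<forall>i\<le>N. singular_chain i X (e i)) \<and>
    (\<forall>i<N. chain_boundary (Suc i) (e (Suc i)) = antipodal_sum i ((-1) ^ Suc i) (e i))"

text \<open>A map that commutes with the antipode induces a chain map that commutes with T, hence
  with every antipodal sum.\<close>

lemma antipodal_tower_chain_map:
  assumes e: "antipodal_tower X N e" and g: "continuous_map X Y g"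
    and odd: "\<And>x. x \<in> topspace X \<Longrightarrow> g (antipode x) = antipode (g x)"
  shows "antipodal_tower Y N (\<lambda>i. chain_map i g (e i))"
proof -
  have "chain_map i g (antipodal_sum i s c) = antipodal_sum i s (chain_map i g c)"
    if c: "singular_chain i X c" for i s c
  proof -
    have "chain_map i (g \<circ> antipode) c = chain_map i (antipode \<circ> g) c"
      by (rule chain_map_eq [OF c]) (simp add: odd)
    then show ?thesis
      by (simp add: antipodal_sum_def chain_map_add chain_map_compose)
  qed
  note ntr = this
  have "chain_boundary (Suc i) (chain_map (Suc i) g (e (Suc i))) = antipodal_sum i ((-1) ^ Suc i) (chain_map i g (e i))"
    if "i < N" for i
  proof -
    have "singular_chain (Suc i) X (e (Suc i))" "singular_chain i X (e i)"
      using e that by (auto simp: antipodal_tower_def)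
    then have "chain_boundary (Suc i) (chain_map (Suc i) g (e (Suc i)))
        = chain_map i g (antipodal_sum i ((-1) ^ Suc i) (e i))"
      using e that by (metis chain_boundary_chain_map antipodal_tower_def diff_Suc_1 One_nat_def)
    also have "\<dots> = antipodal_sum i ((-1) ^ Suc i) (chain_map i g (e i))"
      by (rule ntr) fact
    finally show ?thesis .
  qed
  moreover have "\<exists>f. chain_map 0 g (e 0) = frag_of f"
    using e by (force simp: antipodal_tower_def)
  ultimately show ?thesis
    using e g by (auto simp: antipodal_tower_def singular_chain_chain_map)
qed


section \<open>Towers on spheres whose last antipodal sum generates the top homology\<close>

lemma antipodal_generator_0:
  "\<exists>e. antipodal_tower (nsphere 0) 0 e \<and>
     generated_by (reduced_homology_group 0 (nsphere 0))
       (homologous_rel_set 0 (nsphere 0) {} (antipodal_sum 0 (-1) (e 0)))"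
proof -
  let ?S = "nsphere 0" and ?P = "discrete_topology {()}"
  define a :: "nat \<Rightarrow> real" where "a = (\<lambda>i. if i = 0 then 1 else 0)"
  have ta: "topspace ?S = {a, antipode a}"
    unfolding nsphere by (auto simp: a_def antipode_def fun_eq_iff power2_eq_1_iff)
  define p where "p = restrict (\<lambda>x. a) (standard_simplex 0)"
  define q where "q = simplex_map 0 antipode p"
  have q: "q = restrict (\<lambda>x. antipode a) (standard_simplex 0)"
    by (auto simp: q_def p_def simplex_map_def)
  have sp: "singular_simplex 0 ?S p"
    by (simp add: singular_simplex_def p_def ta)
  have sq: "singular_simplex 0 ?S q"
    by (simp add: q singular_simplex_def ta)
  have pq: "f = p \<or> f = q" if "singular_simplex 0 ?S f" for f
  proof -
    let ?z = "\<lambda>j::nat. if j = 0 then 1 else (0::real)"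
    have "f ?z \<in> {a, antipode a}"
      using that ta by (auto simp: singular_simplex_def continuous_map_def Pi_iff standard_simplex_0)
    moreover have "f = restrict (\<lambda>x. f ?z) (standard_simplex 0)"
    proof (rule ext)
      fix x
      show "f x = restrict (\<lambda>x. f ?z) (standard_simplex 0) x"
        using that by (cases "x = ?z") (simp_all add: singular_simplex_def standard_simplex_0 extensional_def)
    qed
    ultimately show ?thesis
      unfolding q p_def by auto
  qed
  \<comment> \<open>The 0-sphere carries only the simplices \<open>p\<close> and \<open>q\<close>. A
    reduced class has coefficient sum 0, hence is a multiple of
    \<open>frag_of q - frag_of p\<close>.\<close>
  have lin: "\<exists>k l. c = frag_cmul k (frag_of p) + frag_cmul l (frag_of q)" if "singular_chain 0 ?S c" for c
    using that unfolding singular_chain_def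
  proof (induction c rule: frag_induction)
    case zero
    show ?case
      by (intro exI [of _ 0]) simp
  next
    case (one x)
    then have "x = p \<or> x = q"
      using pq by auto
    then show ?case
    proof
      assume "x = p"
      then show ?case
        by (intro exI [of _ 1] exI [of _ 0]) simp
    next
      assume "x = q"
      then show ?case
        by (intro exI [of _ 0] exI [of _ 1]) simp
    qed
  next
    case (diff a b)
    then obtain k l k' l' where "a = frag_cmul k (frag_of p) + frag_cmul l (frag_of q)"
      "b = frag_cmul k' (frag_of p) + frag_cmul l' (frag_of q)"
      by auto
    then have "a - b = frag_cmul (k - k') (frag_of p) + frag_cmul (l - l') (frag_of q)"
      by (simp add: frag_cmul_diff_distrib)
    then show ?case
      by blast
  qed
  define z where "z = antipodal_sum 0 (-1) (frag_of p)"
  have z: "z = frag_of q - frag_of p"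
    by (simp add: z_def antipodal_sum_def q_def)
  define u where "u = simplex_map 0 (\<lambda>x. ()) p"
  have u: "simplex_map 0 (\<lambda>x. ()) q = u"
    by (auto simp: u_def simplex_map_def q p_def)
  have cyc: "singular_relcycle 0 X {} c \<longleftrightarrow> singular_chain 0 X c" for X :: "'x topology" and c
    by (simp add: singular_cycle chain_boundary_def)
  have su: "singular_simplex 0 ?P u"
    unfolding u_def by (rule singular_simplex_simplex_map [OF sp]) simp
  have ind: "hom_induced 0 ?S {} ?P {} (\<lambda>x. ()) (homologous_rel_set 0 ?S {} c)
         = homologous_rel_set 0 ?P {} (chain_map 0 (\<lambda>x. ()) c)" if "singular_chain 0 ?S c" for c
    using hom_induced_chain_map [of ?S ?P "\<lambda>x. ()" "{}" "{}" 0 c] that by (simp add: cyc)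
  have zz: "singular_chain 0 ?S z"
    by (simp add: z singular_chain_diff singular_chain_of sp sq)
  have one: "\<one>\<^bsub>homology_group 0 ?P\<^esub> = homologous_rel_set 0 ?P {} 0"
    using one_relative_homology_group [of 0 ?P "{}"] homologous_rel_set_eq_relboundary [of 0 ?P "{}" 0]
    by simp
  have zcarr: "homologous_rel_set 0 ?S {} z \<in> carrier (reduced_homology_group 0 ?S)"
    using zz unfolding carrier_reduced_homology_group kernel_def
    by (auto simp: ind one z chain_map_diff u u_def carrier_relative_homology_group_0 cyc)
  \<comment> \<open>The zeroth homology of a point is infinite cyclic on the class of
    \<open>u\<close>, so the map to a point detects the coefficient sum.\<close>
  have inj: "k = 0" if "homologous_rel_set 0 ?P {} (frag_cmul k (frag_of u)) = \<one>\<^bsub>homology_group 0 ?P\<^esub>" for k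
  proof -
    have "path_connected_space ?P"
      using path_connectedin_singleton [of ?P "()"] path_connectedin_topspace [of ?P] by simp
    then have iso: "pow (homology_group 0 ?P) (homologous_rel_set 0 ?P {} (frag_of u))
       \<in> iso integer_group (homology_group 0 ?P)"
      by (rule iso_integer_zeroth_homology_group [OF _ su])
    have "homologous_rel_set 0 ?P {} (frag_cmul k (frag_of u))
       = homologous_rel_set 0 ?P {} (frag_of u) [^]\<^bsub>homology_group 0 ?P\<^esub> k"
      using homologous_rel_set_cmul [of 0 ?P "{}" "frag_of u" k] by (simp add: cyc singular_chain_of su)
    then have "homologous_rel_set 0 ?P {} (frag_of u) [^]\<^bsub>homology_group 0 ?P\<^esub> k
      = homologous_rel_set 0 ?P {} (frag_of u) [^]\<^bsub>homology_group 0 ?P\<^esub> (0::int)"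
      using that by simp
    with iso show ?thesis
      by (auto simp: iso_def bij_betw_def inj_on_def)
  qed
  have "generated_by (reduced_homology_group 0 ?S) (homologous_rel_set 0 ?S {} z)"
    unfolding generated_by_def
  proof (intro conjI ballI zcarr)
    fix x assume x: "x \<in> carrier (reduced_homology_group 0 ?S)"
    then obtain c where c: "singular_chain 0 ?S c" "x = homologous_rel_set 0 ?S {} c"
      and h: "hom_induced 0 ?S {} ?P {} (\<lambda>x. ()) x = \<one>\<^bsub>homology_group 0 ?P\<^esub>"
      unfolding carrier_reduced_homology_group kernel_def by (auto simp: carrier_relative_homology_group_0 cyc)
    obtain k l where kl: "c = frag_cmul k (frag_of p) + frag_cmul l (frag_of q)"
      using lin [OF c(1)] by auto
    have "chain_map 0 (\<lambda>x. ()) c = frag_cmul (k + l) (frag_of u)"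
      by (simp add: kl chain_map_add u u_def frag_cmul_distrib)
    then have "k = - l"
      using inj [of "k + l"] h ind [OF c(1)] c(2) by simp
    then have "c = frag_cmul l z"
      by (intro poly_mapping_eqI) (simp add: kl z lookup_add lookup_minus algebra_simps)
    then have "x = homologous_rel_set 0 ?S {} z [^]\<^bsub>homology_group 0 ?S\<^esub> l"
      using homologous_rel_set_cmul [of 0 ?S "{}" z l] zz by (simp add: c(2) cyc)
    also have "\<dots> = homologous_rel_set 0 ?S {} z [^]\<^bsub>reduced_homology_group 0 ?S\<^esub> l"
      using zcarr unfolding reduced_homology_group_def by (simp add: group.int_pow_subgroup_generated)
    finally show "\<exists>k::int. x = homologous_rel_set 0 ?S {} z [^]\<^bsub>reduced_homology_group 0 ?S\<^esub> k"
      by blast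
  qed
  moreover have "antipodal_tower ?S 0 (\<lambda>i. frag_of p)"
    by (auto simp: antipodal_tower_def singular_chain_of sp)
  ultimately show ?thesis
    unfolding z_def by (intro exI [of _ "\<lambda>i. frag_of p"]) simp
qed

text \<open>Here s is 1 or -1, and the power s k of a^s is a^k.\<close>

lemma generated_by_int_pow:
  assumes "group G" "generated_by G a" and s: "s * s = (1::int)"
  shows "generated_by G (a [^]\<^bsub>G\<^esub> s)"
proof -
  interpret group G by fact
  have a: "a \<in> carrier G"
    using assms by (simp add: generated_by_def)
  have "\<exists>k. x = (a [^]\<^bsub>G\<^esub> s) [^]\<^bsub>G\<^esub> (k::int)" if "x \<in> carrier G" for x
  proof -
    have "\<exists>k::int. x = a [^]\<^bsub>G\<^esub> k"
      using assms(2) that by (simp only: generated_by_def)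
    then obtain k :: int where "x = a [^]\<^bsub>G\<^esub> k" ..
    moreover have eq: "s * (s * k) = k"
      using s by (metis mult.assoc mult_1)
    ultimately have "x = (a [^]\<^bsub>G\<^esub> s) [^]\<^bsub>G\<^esub> (s * k)"
      using a by (simp only: int_pow_pow eq)
    then show ?thesis ..
  qed
  then show ?thesis
    using a by (simp add: generated_by_def)
qed

lemma iso_carrier_surj: "\<lbrakk>f \<in> iso G H; y \<in> carrier H\<rbrakk> \<Longrightarrow> \<exists>x\<in>carrier G. f x = y"
  by (force simp: iso_def bij_betw_def)

text \<open>The generating cycle \<zeta> on the equator bounds a chain \<open>e'\<close> in the
  upper hemisphere, whose relative class generates by the boundary isomorphism. Modulo the lower
  hemisphere T \<open>e'\<close> vanishes, so the new antipodal sum T \<open>e'\<close> - s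
  \<open>e'\<close> becomes -s times that generator; since the reduced homology of the sphere is
  isomorphic to its homology relative to the lower hemisphere, it generates as well.\<close>

lemma antipodal_generator_step:
  assumes tower: "antipodal_tower (nsphere n) n e"
    and gen: "generated_by (reduced_homology_group (int n) (nsphere n))
      (homologous_rel_set n (nsphere n) {} (antipodal_sum n ((-1) ^ Suc n) (e n)))"
  shows "\<exists>e. antipodal_tower (nsphere (Suc n)) (Suc n) e \<and>
    generated_by (reduced_homology_group (int (Suc n)) (nsphere (Suc n)))
      (homologous_rel_set (Suc n) (nsphere (Suc n)) {} (antipodal_sum (Suc n) ((-1) ^ Suc (Suc n)) (e (Suc n))))"
proof -
  let ?S = "nsphere (Suc n)" and ?L = "{x::nat\<Rightarrow>real. x (Suc n) \<le> 0}" and ?E = "{x::nat\<Rightarrow>real. x (Suc n) = 0}"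
  let ?U = "subtopology ?S {x. x (Suc n) \<ge> 0}"
  define s :: int where "s = (-1) ^ Suc n"
  have s: "s * s = 1" "- s * - s = 1" and s': "(-1) ^ Suc (Suc n) = - s"
    by (simp_all add: s_def flip: power_add)
  define \<zeta> where "\<zeta> = antipodal_sum n s (e n)"
  have UE: "subtopology ?U ?E = nsphere n"
  proof -
    have "{x. 0 \<le> x (Suc n)} \<inter> {x. x (Suc n) = 0} = {x. x (Suc n) = (0::real)}"
      by auto
    then show ?thesis
      by (simp add: subtopology_subtopology subtopology_nsphere_equator)
  qed
  have eq_int: "1 + int n = int (Suc n)"
    by simp
  have hb: "hom_boundary (int (Suc n)) ?U ?E
      \<in> iso (relative_homology_group (int (Suc n)) ?U ?E) (reduced_homology_group (int n) (nsphere n))"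
    using iso_upper_hemisphere_reduced_homology_group [of "int n" n] unfolding eq_int .
  have "homologous_rel_set n (nsphere n) {} \<zeta> \<in> carrier (reduced_homology_group (int n) (nsphere n))"
    using gen by (simp add: generated_by_def \<zeta>_def s_def)
  then obtain C where C: "C \<in> carrier (relative_homology_group (int (Suc n)) ?U ?E)"
      "hom_boundary (int (Suc n)) ?U ?E C = homologous_rel_set n (nsphere n) {} \<zeta>"
    using iso_carrier_surj [OF hb] by blast
  then obtain c where c: "singular_relcycle (Suc n) ?U ?E c" and Cc: "C = homologous_rel_set (Suc n) ?U ?E c"
    by (auto simp: carrier_relative_homology_group simp del: of_nat_Suc)
  have "homologous_rel_set n (nsphere n) {} (chain_boundary (Suc n) c) = homologous_rel_set n (nsphere n) {} \<zeta>"
    using hom_boundary_chain_boundary [OF c] C(2) UE by (simp add: Cc del: of_nat_Suc)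
  then have "homologous_rel n (nsphere n) {} (chain_boundary (Suc n) c) \<zeta>"
    by (simp add: homologous_rel_set_eq)
  then obtain w where w: "singular_chain (Suc n) (nsphere n) w"
      "chain_boundary (Suc n) w = chain_boundary (Suc n) c - \<zeta>"
    by (auto simp: homologous_rel_def singular_boundary)
  \<comment> \<open>The boundary of \<open>c\<close> is only homologous to \<zeta>, while a tower
    demands equality. The correction \<open>w\<close> lies in the equator, so the relative class
    stays the same.\<close>
  define e' where "e' = c - w"
  have wE: "singular_chain (Suc n) (subtopology ?U ?E) w"
    using w UE by simp
  have e'U: "singular_chain (Suc n) ?U e'"
    using c wE unfolding e'_def
    by (intro singular_chain_diff) (auto simp: singular_relcycle singular_chain_subtopology)
  have be': "chain_boundary (Suc n) e' = \<zeta>"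
    by (simp add: e'_def chain_boundary_diff w)
  have "homologous_rel (Suc n) ?U ?E c e'"
    using singular_chain_imp_relboundary [OF wE] by (simp add: homologous_rel_def e'_def)
  then have Ce': "C = homologous_rel_set (Suc n) ?U ?E e'" and ce': "singular_relcycle (Suc n) ?U ?E e'"
    using c by (simp_all add: Cc homologous_rel_set_eq homologous_rel_singular_relcycle)
  have "generated_by (relative_homology_group (int (Suc n)) ?U ?E) C"
    using generated_by_iso_iff [OF hb _ _ C(1)] gen by (simp add: C(2) \<zeta>_def s_def del: of_nat_Suc)
  then have "generated_by (relative_homology_group (int (Suc n)) ?S ?L) (hom_induced (int (Suc n)) ?U ?E ?S ?L id C)"
    using generated_by_iso_iff [OF iso_relative_homology_group_upper_hemisphere [of "int (Suc n)" "Suc n" "Suc n"] _ _ C(1)]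
    by (simp del: of_nat_Suc)
  moreover have "hom_induced (int (Suc n)) ?U ?E ?S ?L id C = homologous_rel_set (Suc n) ?S ?L e'"
    unfolding Ce' using hom_induced_chain_map [of ?U ?S id ?E ?L "Suc n" e'] ce' e'U
    by (force simp: chain_map_ident continuous_map_from_subtopology simp del: of_nat_Suc)
  ultimately have genSL: "generated_by (relative_homology_group (int (Suc n)) ?S ?L) (homologous_rel_set (Suc n) ?S ?L e')"
    by simp
  have e'S: "singular_chain (Suc n) ?S e'"
    using e'U by (simp add: singular_chain_subtopology)
  define \<zeta>' where "\<zeta>' = antipodal_sum (Suc n) (- s) e'"
  have en: "singular_chain n (nsphere n) (e n)"
    using tower by (simp add: antipodal_tower_def)
  have "chain_boundary (Suc n) \<zeta>' = 0"
    unfolding \<zeta>'_def chain_boundary_antipodal_sum [OF e'S] be' \<zeta>_def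
    by (rule antipodal_sum_antipodal_sum_minus [OF en s(1)])
  then have cyc: "singular_relcycle (Suc n) ?S {} \<zeta>'"
    by (simp add: singular_cycle \<zeta>'_def singular_chain_antipodal_sum e'S)
  then have carr: "homologous_rel_set (Suc n) ?S {} \<zeta>' \<in> carrier (reduced_homology_group (int (Suc n)) ?S)"
    by (simp add: un_reduced_homology_group carrier_relative_homology_group del: of_nat_Suc)
  have relcyc: "singular_relcycle (Suc n) ?S ?L e'"
  proof -
    have "singular_relcycle (Suc n) ?S ?L (chain_map (Suc n) id e')"
      by (rule singular_relcycle_chain_map [OF ce']) (auto simp: continuous_map_from_subtopology)
    then show ?thesis
      using e'U by (simp add: chain_map_ident)
  qed
  \<comment> \<open>The antipode carries the upper hemisphere into the lower one, so T
    \<open>e'\<close> is negligible relative to \<open>?L\<close>.\<close>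
  have "homologous_rel (Suc n) ?S ?L \<zeta>' (frag_cmul (- s) e')"
  proof -
    have "continuous_map ?U (subtopology ?S ?L) antipode"
      using continuous_map_nsphere_antipode [of "Suc n"]
      by (auto simp: continuous_map_in_subtopology continuous_map_from_subtopology antipode_def)
    then have "singular_chain (Suc n) (subtopology ?S ?L) (chain_map (Suc n) antipode e')"
      using e'U singular_chain_chain_map by blast
    then show ?thesis
      unfolding homologous_rel_def \<zeta>'_def antipodal_sum_def
      using singular_chain_imp_relboundary by fastforce
  qed
  then have "hom_induced (int (Suc n)) ?S {} ?S ?L id (homologous_rel_set (Suc n) ?S {} \<zeta>')
      = homologous_rel_set (Suc n) ?S ?L (frag_cmul (- s) e')"
    using hom_induced_chain_map [of ?S ?S id "{}" ?L "Suc n" \<zeta>'] cyc chain_map_ident [of "Suc n" ?S \<zeta>']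
    by (simp add: singular_cycle homologous_rel_set_eq del: of_nat_Suc)
  moreover have "generated_by (relative_homology_group (int (Suc n)) ?S ?L) 
       (homologous_rel_set (Suc n) ?S ?L (frag_cmul (- s) e'))"
    unfolding homologous_rel_set_cmul [OF relcyc]
    by (rule generated_by_int_pow [OF group_relative_homology_group genSL s(2)])
  ultimately have "generated_by (reduced_homology_group (int (Suc n)) ?S) (homologous_rel_set (Suc n) ?S {} \<zeta>')"
    using generated_by_iso_iff [OF iso_reduced_homology_group_lower_hemisphere [of "Suc n" "Suc n" "int (Suc n)"] _ _ carr]
    by (simp del: of_nat_Suc)
  moreover have "antipodal_tower ?S (Suc n) (e(Suc n := e'))"
    unfolding antipodal_tower_def
  proof (intro conjI allI impI)
    show "\<exists>f. (e(Suc n := e')) 0 = frag_of f"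
      using tower by (simp add: antipodal_tower_def)
  next
    fix i assume "i \<le> Suc n"
    then consider "i = Suc n" | "i \<le> n"
      by linarith
    then show "singular_chain i ?S ((e(Suc n := e')) i)"
    proof cases
      \<comment> \<open>The smaller sphere is the equator of the larger, so the old chains serve
        unchanged.\<close>
      case 2
      then have "singular_chain i (subtopology ?S ?E) (e i)"
        using tower by (simp add: antipodal_tower_def subtopology_nsphere_equator)
      then show ?thesis
        using 2 by (simp add: singular_chain_subtopology)
    qed (simp add: e'S)
  next
    fix i assume "i < Suc n"
    then consider "i = n" | "i < n"
      by linarith
    then show "chain_boundary (Suc i) ((e(Suc n := e')) (Suc i)) = antipodal_sum i ((- 1) ^ Suc i) ((e(Suc n := e')) i)"
      using tower by cases (auto simp: antipodal_tower_def be' \<zeta>_def s_def)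
  qed
  ultimately show ?thesis
    unfolding s' \<zeta>'_def by (intro exI [of _ "e(Suc n := e')"]) simp
qed

lemma antipodal_generator:
  "\<exists>e. antipodal_tower (nsphere n) n e \<and>
    generated_by (reduced_homology_group (int n) (nsphere n))
      (homologous_rel_set n (nsphere n) {} (antipodal_sum n ((-1) ^ Suc n) (e n)))"
proof (induction n)
  case 0
  show ?case
    using antipodal_generator_0 by simp
next
  case (Suc n)
  then obtain e where "antipodal_tower (nsphere n) n e"
    "generated_by (reduced_homology_group (int n) (nsphere n))
      (homologous_rel_set n (nsphere n) {} (antipodal_sum n ((-1) ^ Suc n) (e n)))"
    by (elim exE conjE)
  then show ?case
    by (rule antipodal_generator_step)
qed


section \<open>The obstruction to a tower higher than the dimension of the sphere\<close>

lemma generated_by_int_pow_eq_one: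
  assumes "group G" "G \<cong> integer_group" "generated_by G a" "a [^]\<^bsub>G\<^esub> (k::int) = \<one>\<^bsub>G\<^esub>"
  shows "k = 0"
proof -
  obtain f where f: "f \<in> iso G integer_group"
    using assms by (auto simp: is_iso_def)
  interpret group_hom G integer_group f
    using assms f by (simp add: group_hom_def group_hom_axioms_def iso_imp_homomorphism)
  have a: "a \<in> carrier G"
    using assms by (simp add: generated_by_def)
  have "generated_by integer_group (f a)"
    using generated_by_iso_iff [OF f assms(1) _ a] assms(3) by simp
  then have "\<exists>m::int. 1 = f a [^]\<^bsub>integer_group\<^esub> m"
    by (simp add: generated_by_def) metis
  then have "f a \<noteq> 0"
    by auto
  moreover have "f a [^]\<^bsub>integer_group\<^esub> k = 0"
    using hom_int_pow [OF a, of k] assms(4) hom_one by simp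
  ultimately show ?thesis
    by simp
qed

text \<open>The reduced homology of the n-sphere vanishes below degree n. In degree 0 a cycle
  represents a reduced class only if it dies in a point, which is the extra hypothesis.\<close>

lemma singular_relboundary_nsphere:
  assumes "i < n" and z: "singular_relcycle i (nsphere n) {} z"
    and z0: "i = 0 \<Longrightarrow> chain_map 0 (\<lambda>x. ()) z = 0"
  shows "singular_relboundary i (nsphere n) {} z"
proof -
  let ?S = "nsphere n" and ?P = "discrete_topology {()}"
  have "homologous_rel_set i ?S {} z \<in> carrier (reduced_homology_group (int i) ?S)"
  proof (cases "i = 0")
    case True
    have "hom_induced (int i) ?S {} ?P {} (\<lambda>x. ()) (homologous_rel_set i ?S {} z)
        = homologous_rel_set i ?P {} 0"
      using hom_induced_chain_map [of ?S ?P "\<lambda>x. ()" "{}" "{}" i z] z z0 True by simp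
    also have "\<dots> = \<one>\<^bsub>homology_group (int i) ?P\<^esub>"
      using homologous_rel_set_eq_relboundary [of i ?P "{}" 0] by simp
    finally show ?thesis
      using z unfolding carrier_reduced_homology_group kernel_def
      by (simp add: carrier_relative_homology_group)
  next
    case False
    then show ?thesis
      using z by (simp add: un_reduced_homology_group carrier_relative_homology_group)
  qed
  moreover have "trivial_group (reduced_homology_group (int i) ?S)"
    using assms by (simp add: trivial_reduced_homology_group_nsphere)
  ultimately have "homologous_rel_set i ?S {} z = singular_relboundary_set i ?S {}"
    by (simp add: trivial_group_def one_reduced_homology_group)
  then show ?thesis
    by (simp add: homologous_rel_set_eq_relboundary)
qed

text \<open>Any two towers agree, level by level, up to boundaries and antipodal sums. At the top level
  they may differ by \<open>r\<close> times the generator \<open>\<zeta>\<close>, whose antipodal sum is \<open>2 r\<close> times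
  \<open>\<plusminus>\<zeta>\<close>: so the class of the last antipodal sum is always an odd multiple of \<open>\<zeta>\<close>
  and cannot bound.\<close>
lemma not_antipodal_tower_nsphere:
  assumes "1 \<le> n"
  shows "\<not> antipodal_tower (nsphere n) (Suc n) d"
proof
  let ?S = "nsphere n"
  assume d: "antipodal_tower ?S (Suc n) d"
  obtain e where e: "antipodal_tower ?S n e"
    and gen: "generated_by (reduced_homology_group (int n) ?S)
      (homologous_rel_set n ?S {} (antipodal_sum n ((-1) ^ Suc n) (e n)))"
    using antipodal_generator [of n] by (elim exE conjE)
  have sing: "singular_chain i ?S (d i)" "singular_chain i ?S (e i)" if "i \<le> n" for i
    using d e that by (auto simp: antipodal_tower_def)
  \<comment> \<open>The difference of the two towers at level i, corrected by T + (-1)^i applied to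
    a chain \<open>b\<close> found at the level below.\<close>
  define z where "z = (\<lambda>i b. d i - e i - antipodal_sum i ((-1) ^ i) b)"
  have sq: "(-1) ^ i * (-1) ^ i = (1::int)" for i
    by (simp flip: power_add)
  \<comment> \<open>The correction is killed by the antipodal sum of the opposite sign.\<close>
  have Sz: "antipodal_sum i ((-1) ^ Suc i) (z i b)
      = antipodal_sum i ((-1) ^ Suc i) (d i) - antipodal_sum i ((-1) ^ Suc i) (e i)"
    if "singular_chain i ?S b" for i b
    using antipodal_sum_antipodal_sum_minus [OF that sq [of i]]
    by (simp add: z_def antipodal_sum_diff)
  \<comment> \<open>The clause for i = 0 keeps \<open>z 0 b\<close> a plain difference of two
    points, which bounds because both towers start with a single simplex.\<close>
  have cz: "\<exists>b. singular_chain i ?S b \<and> singular_relcycle i ?S {} (z i b) \<and> (i = 0 \<longrightarrow> b = 0)"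
    if "i \<le> n" for i
    using that
  proof (induction i)
    case 0
    have "singular_relcycle 0 ?S {} (z 0 0)"
      using sing [of 0]
      by (simp add: z_def singular_cycle chain_boundary_def antipodal_sum_def singular_chain_diff)
    then show ?case
      by (intro exI [of _ 0]) simp
  next
    case (Suc i)
    then obtain b where b: "singular_chain i ?S b" "singular_relcycle i ?S {} (z i b)" "i = 0 \<longrightarrow> b = 0"
      by auto
    have "singular_relboundary i ?S {} (z i b)"
    proof (rule singular_relboundary_nsphere)
      show "i < n"
        using Suc.prems by simp
      assume "i = 0"
      obtain f g where fg: "d 0 = frag_of f" "e 0 = frag_of g"
        using d e by (auto simp: antipodal_tower_def)
      have "simplex_map 0 (\<lambda>x. ()) f = simplex_map 0 (\<lambda>x. ()) g"
        by (auto simp: simplex_map_def)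
      then show "chain_map 0 (\<lambda>x. ()) (z i b) = 0"
        using \<open>i = 0\<close> b(3) fg by (simp add: z_def antipodal_sum_def chain_map_diff)
    qed fact
    \<comment> \<open>A chain bounded by the corrected difference at level i is the correction at
      the next level: the boundaries of the two towers and of the correction then cancel.\<close>
    then obtain b' where b': "singular_chain (Suc i) ?S b'" "chain_boundary (Suc i) b' = z i b"
      by (auto simp: singular_boundary)
    have "chain_boundary (Suc i) (d (Suc i)) = antipodal_sum i ((-1) ^ Suc i) (d i)"
         "chain_boundary (Suc i) (e (Suc i)) = antipodal_sum i ((-1) ^ Suc i) (e i)"
      using d e Suc.prems by (simp_all add: antipodal_tower_def)
    moreover have "z (Suc i) b' = d (Suc i) - e (Suc i) - antipodal_sum (Suc i) ((-1) ^ Suc i) b'"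
      by (simp add: z_def)
    ultimately have "chain_boundary (Suc i) (z (Suc i) b') = 0"
      using chain_boundary_antipodal_sum [OF b'(1)] Sz [OF b(1)] b'(2)
      by (simp only: chain_boundary_diff diff_self)
        moreover have "singular_chain (Suc i) ?S (z (Suc i) b')"
      using sing [OF Suc.prems] b'(1) by (simp add: z_def singular_chain_diff singular_chain_antipodal_sum)
    ultimately show ?case
      using b'(1) by (intro exI [of _ b']) (simp add: singular_cycle)
  qed
  obtain b where b: "singular_chain n ?S b" "singular_relcycle n ?S {} (z n b)"
    using cz [of n] by auto
  define s :: int where "s = (-1) ^ Suc n"
  have s: "s * s = 1"
    unfolding s_def by (rule sq)
  define \<zeta> where "\<zeta> = antipodal_sum n s (e n)"
  have n0: "int n \<noteq> 0"
    using assms by simp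
  have gen': "generated_by (homology_group (int n) ?S) (homologous_rel_set n ?S {} \<zeta>)"
    using gen unfolding un_reduced_homology_group [OF n0] \<zeta>_def s_def .
  have c\<zeta>: "singular_relcycle n ?S {} \<zeta>"
  proof -
    obtain m where m: "n = Suc m"
      using assms by (cases n) auto
    have "chain_boundary (Suc m) (e (Suc m)) = antipodal_sum m ((-1) ^ Suc m) (e m)"
      using e m by (simp add: antipodal_tower_def)
    moreover have "singular_chain m ?S (e m)" "singular_chain (Suc m) ?S (e (Suc m))"
      using sing m by auto
    ultimately have "chain_boundary n \<zeta> = 0"
      using antipodal_sum_antipodal_sum_minus [of m ?S "e m" "(-1) ^ Suc m"] sq [of "Suc m"]
      by (simp add: m \<zeta>_def s_def chain_boundary_antipodal_sum)
    then show ?thesis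
      using sing [of n] by (simp add: singular_cycle \<zeta>_def singular_chain_antipodal_sum)
  qed
  have "homologous_rel_set n ?S {} (z n b) \<in> carrier (homology_group (int n) ?S)"
    using b by (simp add: carrier_relative_homology_group)
  then have "\<exists>r::int. homologous_rel_set n ?S {} (z n b) = homologous_rel_set n ?S {} \<zeta> [^]\<^bsub>homology_group (int n) ?S\<^esub> r"
    using gen' by (simp only: generated_by_def)
  then obtain r where "homologous_rel_set n ?S {} (z n b) = homologous_rel_set n ?S {} (frag_cmul r \<zeta>)"
    unfolding homologous_rel_set_cmul [OF c\<zeta>, symmetric] ..
  then have "singular_relboundary n ?S {} (z n b - frag_cmul r \<zeta>)"
    by (simp only: homologous_rel_set_eq) (simp only: homologous_rel_def)
  then obtain w where w: "singular_chain (Suc n) ?S w" "chain_boundary (Suc n) w = z n b - frag_cmul r \<zeta>"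
    by (auto simp: singular_boundary)
  have dn: "singular_chain (Suc n) ?S (d (Suc n))" "chain_boundary (Suc n) (d (Suc n)) = antipodal_sum n s (d n)"
    using d by (simp_all add: antipodal_tower_def s_def)
  have "antipodal_sum n s \<zeta> = frag_cmul (2 * s) \<zeta>"
    unfolding \<zeta>_def using sing [of n] s by (intro antipodal_sum_antipodal_sum) auto
  then have "chain_boundary (Suc n) (d (Suc n) - antipodal_sum (Suc n) s w)
      = antipodal_sum n s (d n) - (antipodal_sum n s (z n b) - frag_cmul r (frag_cmul (2 * s) \<zeta>))"
    unfolding chain_boundary_diff chain_boundary_antipodal_sum [OF w(1)] w(2) dn(2)
    by (simp add: antipodal_sum_diff antipodal_sum_cmul)
  \<comment> \<open>The 1 comes from the tower \<open>e\<close>, the even part from (T + s) \<zeta>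
    = 2 s \<zeta>.\<close>
  also have "\<dots> = frag_cmul (1 + 2 * r * s) \<zeta>"
  proof -
    have "antipodal_sum n s (z n b) = antipodal_sum n s (d n) - \<zeta>"
      unfolding s_def \<zeta>_def by (rule Sz [OF b(1)])
    moreover have "frag_cmul (1 + 2 * r * s) \<zeta> = \<zeta> + frag_cmul (2 * r * s) \<zeta>"
      by (simp only: frag_cmul_distrib frag_cmul_one)
    ultimately show ?thesis
      by (simp add: mult_ac)
  qed
  finally have "singular_relboundary n ?S {} (frag_cmul (1 + 2 * r * s) \<zeta>)"
    unfolding singular_boundary
    using dn(1) w(1) singular_chain_antipodal_sum singular_chain_diff by blast
  then have "homologous_rel_set n ?S {} \<zeta> [^]\<^bsub>homology_group (int n) ?S\<^esub> (1 + 2 * r * s) = \<one>\<^bsub>homology_group (int n) ?S\<^esub>"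
    unfolding homologous_rel_set_cmul [OF c\<zeta>, symmetric] one_relative_homology_group
    by (simp only: homologous_rel_set_eq_relboundary)
  moreover have "homology_group (int n) ?S \<cong> integer_group"
    using reduced_homology_group_nsphere(1) [of n] unfolding un_reduced_homology_group [OF n0] .
  ultimately have "1 + 2 * r * s = 0"
    using generated_by_int_pow_eq_one [OF group_relative_homology_group _ gen'] by blast
  then have "2 * (r * s) = - 1"
    by simp
  then show False
    by presburger
qed

text \<open>An odd map would push the full tower of the larger sphere forward to one that is too
  high for the smaller sphere.\<close>

theorem no_odd_map_nsphere_Suc:
  assumes "1 \<le> n" and f: "continuous_map (nsphere (Suc n)) (nsphere n) f"
    and odd: "\<And>x. x \<in> topspace (nsphere (Suc n)) \<Longrightarrow> f (antipode x) = antipode (f x)"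
  shows False
proof -
  obtain e where "antipodal_tower (nsphere (Suc n)) (Suc n) e"
    using antipodal_generator [of "Suc n"] by (elim exE conjE)
  then have "antipodal_tower (nsphere n) (Suc n) (\<lambda>i. chain_map i f (e i))"
    using f odd by (rule antipodal_tower_chain_map)
  then show False
    using not_antipodal_tower_nsphere [OF assms(1)] by blast
qed

text \<open>Without a common zero the vector of the \<open>\<Phi> i\<close> can be normalised to an
  odd map into the sphere of one dimension less.\<close>

theorem Borsuk_Ulam_nsphere:
  fixes \<Phi> :: "nat \<Rightarrow> (nat \<Rightarrow> real) \<Rightarrow> real"
  assumes "2 \<le> N"
    and cont: "\<And>i. i < N \<Longrightarrow> continuous_map (nsphere N) euclideanreal (\<Phi> i)"
    and odd: "\<And>i x. \<lbrakk>i < N; x \<in> topspace (nsphere N)\<rbrakk> \<Longrightarrow> \<Phi> i (antipode x) = - \<Phi> i x"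
  shows "\<exists>x\<in>topspace (nsphere N). \<forall>i<N. \<Phi> i x = 0"
proof (rule ccontr)
  assume no: "\<not> ?thesis"
  obtain n where N: "N = Suc n" and n: "1 \<le> n"
    using assms(1) by (cases N) auto
  define r where "r = (\<lambda>x. sqrt (\<Sum>i\<le>n. (\<Phi> i x)\<^sup>2))"
  define f where "f = (\<lambda>x i. if i \<le> n then \<Phi> i x / r x else 0)"
  have r2: "(r x)\<^sup>2 = (\<Sum>i\<le>n. (\<Phi> i x)\<^sup>2)" for x
    by (simp add: r_def sum_nonneg)
  have r0: "r x \<noteq> 0" if "x \<in> topspace (nsphere N)" for x
    using no that by (auto simp: r_def sum_nonneg_eq_0_iff N less_Suc_eq_le)
  have contr: "continuous_map (nsphere N) euclideanreal r"
    unfolding r_def using cont by (intro continuous_intros) (auto simp: N)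
  have cf: "continuous_map (nsphere N) euclideanreal (\<lambda>x. f x i)" for i
  proof (cases "i \<le> n")
    case True
    then have "continuous_map (nsphere N) euclideanreal (\<lambda>x. \<Phi> i x / r x)"
      using cont contr r0 by (intro continuous_map_real_divide) (auto simp: N)
    then show ?thesis
      using True by (simp add: f_def)
  qed (simp add: f_def)
  have "(\<Sum>i\<le>n. (f x i)\<^sup>2) = 1" if "x \<in> topspace (nsphere N)" for x
    using r0 [OF that] by (simp add: f_def power_divide r2 flip: sum_divide_distrib) (metis r2 zero_eq_power2)
  then have "continuous_map (nsphere N) (nsphere n) f"
    unfolding nsphere [of n] continuous_map_in_subtopology continuous_map_componentwise_UNIV
    using cf by (auto simp: f_def)
  moreover have "f (antipode x) = antipode (f x)" if "x \<in> topspace (nsphere N)" for x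
  proof -
    have \<Phi>: "\<Phi> i (antipode x) = - \<Phi> i x" if "i \<le> n" for i
      using odd \<open>x \<in> topspace (nsphere N)\<close> that by (simp add: N)
    then have "r (antipode x) = r x"
      unfolding r_def by (intro arg_cong [of _ _ sqrt] sum.cong) auto
    with \<Phi> show ?thesis
      by (auto simp: f_def fun_eq_iff antipode_def [of "f x"] antipode_def [of "\<lambda>i. if i \<le> n then _ i else 0"])
  qed
  ultimately show False
    using no_odd_map_nsphere_Suc [OF n] unfolding N by blast
qed

section \<open>Covering dimension of zero sets of odd maps\<close>

text \<open>If \<open>w u\<close> were nonzero, let \<open>q\<close> be the polynomial whose roots
  are the other nodes with nonzero weight. Its degree is below D, so the vanishing moments
  annihilate it, yet the weighted sum of its values reduces to the nonzero term at
  \<open>u\<close>.\<close>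

lemma Vandermonde_sparse_eq_0:
  fixes c w :: "'v \<Rightarrow> 'r::field"
  assumes "finite S" "inj_on c S" and card: "card {v\<in>S. w v \<noteq> 0} \<le> D"
    and 0: "\<And>p. p < D \<Longrightarrow> (\<Sum>v\<in>S. c v ^ p * w v) = 0" and "u \<in> S"
  shows "w u = 0"
proof (rule ccontr)
  assume "w u \<noteq> 0"
  define T where "T = {v\<in>S. w v \<noteq> 0} - {u}"
  define q where "q = (\<Prod>v\<in>T. [:- c v, 1:])"
  have finT: "finite T" and uT: "u \<notin> T" and TS: "T \<subseteq> S"
    using assms by (auto simp: T_def)
  have "card T < D"
  proof -
    have "card T < card {v\<in>S. w v \<noteq> 0}"
      unfolding T_def using assms \<open>w u \<noteq> 0\<close> by (intro card_Diff1_less) auto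
    then show ?thesis
      using card by simp
  qed
  moreover have "degree q \<le> card T"
    unfolding q_def using degree_prod_sum_le [OF finT, of "\<lambda>v. [:- c v, 1:]"] by simp
  ultimately have deg: "degree q < D"
    by simp
  have "(\<Sum>v\<in>S. poly q (c v) * w v) = (\<Sum>v\<in>S. \<Sum>p\<le>degree q. poly.coeff q p * (c v ^ p * w v))"
    by (simp only: poly_altdef sum_distrib_right mult.assoc)
  also have "\<dots> = (\<Sum>p\<le>degree q. poly.coeff q p * (\<Sum>v\<in>S. c v ^ p * w v))"
    by (subst sum.swap) (simp add: sum_distrib_left)
  also have "\<dots> = 0"
    using 0 deg by simp
  finally have "(\<Sum>v\<in>S. poly q (c v) * w v) = 0" .
  moreover have "(\<Sum>v\<in>S. poly q (c v) * w v) = (\<Sum>v\<in>{u}. poly q (c v) * w v)"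
  proof (rule sum.mono_neutral_right)
    show "\<forall>v\<in>S - {u}. poly q (c v) * w v = 0"
      using finT by (auto simp: q_def poly_prod T_def)
  qed (use assms in auto)
  moreover have "poly q (c u) \<noteq> 0"
    using finT uT TS \<open>u \<in> S\<close> \<open>inj_on c S\<close>
    by (auto simp: q_def poly_prod inj_on_def)
  ultimately show False
    using \<open>w u \<noteq> 0\<close> by simp
qed


section \<open>Spheres as closed symmetric subsets of the product space\<close>

lemma nsphere_eq_top_of_set: "nsphere N = top_of_set (topspace (nsphere N))"
  unfolding nsphere by (simp add: euclidean_product_topology)

lemma closed_topspace_nsphere: "closed (topspace (nsphere N))"
proof -
  have "topspace (nsphere N) = {x. (\<Sum>i\<le>N. (x i)\<^sup>2) = 1} \<inter> (\<Inter>i\<in>{N<..}. {x. x i = 0})"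
    by (auto simp: nsphere)
  moreover have "closed \<dots>"
    by (intro closed_Int closed_INT ballI closed_Collect_eq continuous_intros
        continuous_on_product_coordinates)
  ultimately show ?thesis
    by simp
qed

lemma antipode_in_topspace_nsphere: "antipode x \<in> topspace (nsphere N) \<longleftrightarrow> x \<in> topspace (nsphere N)"
  by (simp add: nsphere antipode_def)

lemma continuous_on_antipode: "continuous_on S antipode"
proof -
  have "continuous_on UNIV antipode"
    unfolding antipode_def
    by (intro continuous_on_coordinatewise_then_product continuous_intros
        continuous_on_product_coordinates)
  then show ?thesis
    using continuous_on_subset by blast
qed

text \<open>Borsuk-Ulam is applied to the k functions \<open>F i\<close> together with 2 * (d + 1)
  moments of odd bump functions. The cover is indexed through \<open>P\<close> because its members
  will be traces on the sphere of open sets of loops.\<close>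

lemma antipodal_cover_of_zero_set:
  fixes F :: "nat \<Rightarrow> (nat \<Rightarrow> real) \<Rightarrow> real" and P :: "'v \<Rightarrow> (nat \<Rightarrow> real) set" and k d :: nat
  defines "N \<equiv> k + 2 * (d + 1)"
  defines "Z \<equiv> {x \<in> topspace (nsphere N). \<forall>i<k. F i x = 0}"
  assumes cont: "\<And>i. i < k \<Longrightarrow> continuous_on (topspace (nsphere N)) (F i)"
    and odd: "\<And>i x. \<lbrakk>i < k; x \<in> topspace (nsphere N)\<rbrakk> \<Longrightarrow> F i (antipode x) = - F i x"
    and fin: "finite \<V>"
    and ope: "\<And>V. V \<in> \<V> \<Longrightarrow> openin (top_of_set Z) (P V)"
    and cov: "Z \<subseteq> (\<Union>V\<in>\<V>. P V)"
    and anti: "\<And>V x. \<lbrakk>V \<in> \<V>; x \<in> P V\<rbrakk> \<Longrightarrow> antipode x \<notin> P V"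
    and ord: "\<And>x. x \<in> Z \<Longrightarrow> card {V \<in> \<V>. x \<in> P V} \<le> d + 1"
  shows False
proof -
  let ?S = "topspace (nsphere N)"
  have closZ: "closed Z"
  proof -
    have "Z = ?S \<inter> (\<Inter>i\<in>{..<k}. ?S \<inter> F i -` {0})"
      by (auto simp: Z_def)
    moreover have "closed (?S \<inter> F i -` {0})" if "i < k" for i
      using cont [OF that] closed_topspace_nsphere by (intro continuous_closed_preimage) auto
    ultimately show ?thesis
      using closed_topspace_nsphere by (metis closed_Int closed_INT lessThan_iff)
  qed
  have antiZ: "antipode x \<in> Z" if "x \<in> Z" for x
    using that odd by (auto simp: Z_def antipode_in_topspace_nsphere)
  have PZ: "P V \<subseteq> Z" if "V \<in> \<V>" for V
    using ope [OF that] by (simp add: openin_imp_subset)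
  define \<phi> where "\<phi> = (\<lambda>V x. infdist x (Z - P V))"
  have \<phi>: "\<phi> V x \<noteq> 0 \<longleftrightarrow> x \<in> P V" if "V \<in> \<V>" "x \<in> Z" for V x
  proof (cases "x \<in> P V")
    case True
    have "closed (Z - P V)"
    proof -
      obtain T where "open T" "P V = Z \<inter> T"
        using ope [OF \<open>V \<in> \<V>\<close>] by (auto simp: openin_open)
      then have "Z - P V = Z - T"
        by auto
      then show ?thesis
        using closZ \<open>open T\<close> by (simp add: closed_Diff)
    qed
    \<comment> \<open>The distance to an empty set is 0 by convention; the antipode shows that the
      complement is nonempty.\<close>
    moreover have "antipode x \<in> Z - P V"
      using True anti antiZ that by auto
    ultimately show ?thesis
      using True unfolding \<phi>_def by (metis DiffD2 empty_iff in_closed_iff_infdist_zero)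
  next
    case False
    then show ?thesis
      using that by (simp add: \<phi>_def)
  qed
  define \<psi> where "\<psi> = (\<lambda>V x. \<phi> V x - \<phi> V (antipode x))"
  have \<psi>_odd: "\<psi> V (antipode x) = - \<psi> V x" for V x
    by (simp add: \<psi>_def)
  have \<psi>_cont: "continuous_on T (\<psi> V)" for V T
    unfolding \<psi>_def \<phi>_def by (intro continuous_intros continuous_on_antipode)
  \<comment> \<open>Nothing cancels: at most one of \<open>x\<close> and its antipode lies in
    \<open>P V\<close>.\<close>
  have \<psi>0: "\<psi> V x \<noteq> 0 \<longleftrightarrow> x \<in> P V \<or> antipode x \<in> P V" if "V \<in> \<V>" "x \<in> Z" for V x
  proof -
    have "\<phi> V x \<noteq> 0 \<longleftrightarrow> x \<in> P V" "\<phi> V (antipode x) \<noteq> 0 \<longleftrightarrow> antipode x \<in> P V"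
      using \<phi> that antiZ by auto
    then show ?thesis
      using anti [OF that(1)] unfolding \<psi>_def by force
  qed
  \<comment> \<open>An injective numbering of the cover supplies distinct Vandermonde nodes.\<close>
  obtain c :: "'v \<Rightarrow> nat" where "inj_on c \<V>"
    using finite_imp_inj_to_nat_seg [OF fin] by metis
  then have inj: "inj_on (\<lambda>V. real (c V)) \<V>"
    by (auto simp: inj_on_def)
  \<comment> \<open>Moments of the \<open>\<psi> V x\<close>: as at most \<open>2 * (d + 1)\<close> of these are nonzero, that many moments detect
    whether all of them vanish.\<close>
  define \<Phi> where "\<Phi> = (\<lambda>i x. if i < k then F i x else \<Sum>V\<in>\<V>. real (c V) ^ (i - k) * \<psi> V x)"
  have "\<exists>x\<in>?S. \<forall>i<N. \<Phi> i x = 0"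
  proof (rule Borsuk_Ulam_nsphere)
    show "2 \<le> N"
      by (simp add: N_def)
    fix i assume "i < N"
    have "continuous_on ?S (\<Phi> i)"
      unfolding \<Phi>_def using cont [of i] by (cases "i < k") (auto intro!: continuous_intros \<psi>_cont)
    then show "continuous_map (nsphere N) euclideanreal (\<Phi> i)"
      by (subst nsphere_eq_top_of_set) simp
    show "\<Phi> i (antipode x) = - \<Phi> i x" if "x \<in> ?S" for x
      using odd that by (simp add: \<Phi>_def \<psi>_odd sum_negf)
  qed
  then obtain x where x: "x \<in> ?S" and \<Phi>x: "\<And>i. i < N \<Longrightarrow> \<Phi> i x = 0"
    by blast
  have xZ: "x \<in> Z"
    unfolding Z_def using x
  proof (intro CollectI conjI allI impI)
    fix i assume "i < k"
    then show "F i x = 0"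
      using \<Phi>x [of i] by (simp add: \<Phi>_def N_def)
  qed
  \<comment> \<open>The order bound is used twice, at \<open>x\<close> and at its antipode.\<close>
  have "card {V \<in> \<V>. \<psi> V x \<noteq> 0} \<le> 2 * (d + 1)"
  proof -
    have "{V \<in> \<V>. \<psi> V x \<noteq> 0} = {V \<in> \<V>. x \<in> P V} \<union> {V \<in> \<V>. antipode x \<in> P V}"
      using \<psi>0 xZ by auto
    then have "card {V \<in> \<V>. \<psi> V x \<noteq> 0} \<le> card {V \<in> \<V>. x \<in> P V} + card {V \<in> \<V>. antipode x \<in> P V}"
      by (simp add: card_Un_le)
    then show ?thesis
      using ord [OF xZ] ord [OF antiZ [OF xZ]] by simp
  qed
  moreover have "(\<Sum>V\<in>\<V>. real (c V) ^ p * \<psi> V x) = 0" if "p < 2 * (d + 1)" for p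
    using \<Phi>x [of "k + p"] that by (simp add: \<Phi>_def N_def)
  ultimately have "\<psi> V x = 0" if "V \<in> \<V>" for V
    using Vandermonde_sparse_eq_0 [OF fin inj, of "\<lambda>V. \<psi> V x"] that by blast
  then show False
    using cov xZ \<psi>0 by blast
qed

section \<open>Spheres of loops in a great circle\<close>

lemma norm_loop: "\<lbrakk>\<alpha> \<in> loops s0; t \<in> {0..1}\<rbrakk> \<Longrightarrow> norm (\<alpha> t) = 1"
  by (auto simp: loops_def image_subset_iff)

lemma topspace_loop_top: "topspace (loop_top s0) = loops s0"
proof -
  \<comment> \<open>The empty compact set imposes no condition, so the whole loop space is a
    subbasic set.\<close>
  have "loops s0 \<in> {{\<alpha> \<in> loops s0. \<alpha> ` K \<subseteq> U} | K U.
        compact K \<and> K \<subseteq> {0..1} \<and> openin (top_of_set (sphere (0::'a) 1)) U}"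
    by (rule CollectI, rule exI [of _ "{}"], rule exI [of _ "{}"]) auto
  then show ?thesis
    unfolding loop_top_def topology_generated_by_topspace by blast
qed

lemma continuous_map_loop_eval:
  fixes s0 :: "'a::euclidean_space"
  assumes t: "t \<in> {0..1}"
  shows "continuous_map (loop_top s0) euclidean (\<lambda>\<alpha>. \<alpha> t)"
  unfolding continuous_map_def
proof (intro conjI allI impI)
  fix U :: "'a set" assume "openin euclidean U"
  then have "openin (top_of_set (sphere (0::'a) 1)) (sphere 0 1 \<inter> U)"
    by (simp add: openin_open_Int)
  then have "openin (loop_top s0) {\<alpha> \<in> loops s0. \<alpha> ` {t} \<subseteq> sphere 0 1 \<inter> U}"
    unfolding loop_top_def using t
    by (intro topology_generated_by_Basis CollectI exI [of _ "{t}"] exI [of _ "sphere 0 1 \<inter> U"] conjI refl) auto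
  moreover have "{\<alpha> \<in> loops s0. \<alpha> ` {t} \<subseteq> sphere 0 1 \<inter> U} = {\<alpha> \<in> topspace (loop_top s0). \<alpha> t \<in> U}"
    unfolding topspace_loop_top using t norm_loop by auto
  ultimately show "openin (loop_top s0) {\<alpha> \<in> topspace (loop_top s0). \<alpha> t \<in> U}"
    by simp
qed auto

lemma continuous_map_into_loop_top:
  fixes a :: "'x::topological_space \<Rightarrow> real \<Rightarrow> 'a::euclidean_space"
  assumes cont: "continuous_on (S \<times> {0..1}) (\<lambda>(x, t). a x t)"
    and a: "\<And>x. x \<in> S \<Longrightarrow> a x \<in> loops s0"
  shows "continuous_map (top_of_set S) (loop_top s0) a"
  unfolding loop_top_def
proof (rule continuous_on_generated_topo)
  show "a ` topspace (top_of_set S) \<subseteq> \<Union> {{\<alpha> \<in> loops s0. \<alpha> ` K \<subseteq> U} | K U.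
        compact K \<and> K \<subseteq> {0..1} \<and> openin (top_of_set (sphere (0::'a) 1)) U}"
    using a topspace_loop_top [of s0] unfolding loop_top_def topology_generated_by_topspace by auto
next
  fix B assume "B \<in> {{\<alpha> \<in> loops s0. \<alpha> ` K \<subseteq> U} | K U.
        compact K \<and> K \<subseteq> {0..1} \<and> openin (top_of_set (sphere (0::'a) 1)) U}"
  then obtain K V where K: "compact K" "K \<subseteq> {0..1}" and V: "open V"
    and B: "B = {\<alpha> \<in> loops s0. \<alpha> ` K \<subseteq> sphere 0 1 \<inter> V}"
    by (auto simp: openin_open)
  let ?T = "top_of_set {0..1::real}"
  \<comment> \<open>\<open>A\<close> is not compact, so the half-spaces alone need not cover it; \<open>W\<close> contains the rest and
    misses the embedded sphere.\<close>
  define W where "W = (S \<times> {0..1}) \<inter> (\<lambda>(x, t). a x t) -` V"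
  have W: "openin (prod_topology (top_of_set S) ?T) W"
    unfolding W_def using continuous_openin_preimage_gen [OF cont V] by simp
  \<comment> \<open>The open set \<open>W\<close> of pairs sent into \<open>V\<close> contains {x}
    \<times> K, so by the tube lemma it contains U \<times> K for a neighbourhood U of x.\<close>
  have "\<exists>U. openin (top_of_set S) U \<and> x \<in> U \<and> U \<subseteq> a -` B \<inter> S" if x: "x \<in> a -` B \<inter> S" for x
  proof -
    have "{x} \<times> K \<subseteq> W"
      using x K by (auto simp: W_def B)
    then obtain U U' where U: "openin (top_of_set S) U" "x \<in> U" "K \<subseteq> U'" "U \<times> U' \<subseteq> W"
      using tube_lemma_right [OF W, of K x] K x by (auto simp: compactin_subtopology)
    have "U \<subseteq> a -` B \<inter> S"
    proof
      fix y assume y: "y \<in> U"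
      then have yS: "y \<in> S"
        using U(1) openin_imp_subset by blast
      have "a y t \<in> sphere 0 1 \<inter> V" if "t \<in> K" for t
      proof -
        have "(y, t) \<in> W"
          using U y that by blast
        moreover have "norm (a y t) = 1"
          using norm_loop [OF a [OF yS]] K that by blast
        ultimately show ?thesis
          by (simp add: W_def)
      qed
      then show "y \<in> a -` B \<inter> S"
        using yS a by (auto simp: B)
    qed
    with U show ?thesis
      by blast
  qed
  then have "openin (top_of_set S) (a -` B \<inter> S)"
    by (subst openin_subopen) blast
  then show "openin (top_of_set S) (a -` B \<inter> topspace (top_of_set S))"
    by simp
qed

section \<open>Piecewise linear functions that are odd about 1/2\<close>

definition tent_node :: "nat \<Rightarrow> nat \<Rightarrow> real"
  where "tent_node N i = 1 / 2 + (real i + 1) / (2 * (real N + 2))"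

text \<open>A hat of height 1 whose half-width is the spacing of the nodes, so it vanishes at all
  other nodes. For i \<le> N the nodes keep one spacing away from 1/2 and 1, so its support lies
  between these points.\<close>

definition tent :: "nat \<Rightarrow> nat \<Rightarrow> real \<Rightarrow> real"
  where "tent N i t = max 0 (1 - 2 * (real N + 2) * \<bar>t - tent_node N i\<bar>)"

definition odd_tent :: "nat \<Rightarrow> nat \<Rightarrow> real \<Rightarrow> real"
  where "odd_tent N i t = tent N i t - tent N i (1 - t)"

lemma tent_node_bounds:
  assumes "i \<le> N"
  shows "1 / 2 < tent_node N i" "tent_node N i < 1"
  using assms by (auto simp: tent_node_def field_simps)

lemma tent_eq_0_left:
  assumes "t \<le> 1 / 2"
  shows "tent N i t = 0"
proof -
  have "(real i + 1) / (2 * (real N + 2)) \<le> \<bar>t - tent_node N i\<bar>"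
    using assms by (simp add: tent_node_def)
  then have "real i + 1 \<le> 2 * (real N + 2) * \<bar>t - tent_node N i\<bar>"
    by (simp add: field_simps)
  then show ?thesis
    by (simp add: tent_def)
qed

lemma tent_eq_0_right:
  assumes "i \<le> N" "1 \<le> t"
  shows "tent N i t = 0"
proof -
  have "1 / 2 - (real i + 1) / (2 * (real N + 2)) \<le> \<bar>t - tent_node N i\<bar>"
    using assms by (simp add: tent_node_def)
  then have "real N + 2 - (real i + 1) \<le> 2 * (real N + 2) * \<bar>t - tent_node N i\<bar>"
    by (simp add: field_simps)
  then show ?thesis
    using assms by (simp add: tent_def)
qed

lemma odd_tent_outside: "\<lbrakk>i \<le> N; t \<le> 0 \<or> 1 \<le> t\<rbrakk> \<Longrightarrow> odd_tent N i t = 0"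
  by (auto simp: odd_tent_def tent_eq_0_left tent_eq_0_right)

lemma odd_tent_reflect: "odd_tent N i (1 - t) = - odd_tent N i t"
  by (simp add: odd_tent_def)

lemma odd_tent_node:
  assumes "j \<le> N"
  shows "odd_tent N i (tent_node N j) = (if i = j then 1 else 0)"
proof -
  have "tent N i (1 - tent_node N j) = 0"
    using tent_node_bounds [OF assms] by (intro tent_eq_0_left) simp
  moreover have "2 * (real N + 2) * \<bar>tent_node N j - tent_node N i\<bar> = \<bar>real j - real i\<bar>"
  proof -
    have "tent_node N j - tent_node N i = (real j - real i) / (2 * (real N + 2))"
      by (simp add: tent_node_def flip: diff_divide_distrib)
    then show ?thesis
      by (simp add: abs_divide)
  qed
  ultimately show ?thesis
    by (auto simp: odd_tent_def tent_def)
qed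

lemma continuous_on_odd_tent: "continuous_on S f \<Longrightarrow> continuous_on S (\<lambda>x. odd_tent N i (f x))"
  unfolding odd_tent_def tent_def by (intro continuous_intros)

text \<open>The interpolation of the coordinates of \<open>x\<close> at the nodes, extended oddly
  about 1/2.\<close>

definition wave :: "nat \<Rightarrow> (nat \<Rightarrow> real) \<Rightarrow> real \<Rightarrow> real"
  where "wave N x t = (\<Sum>i\<le>N. x i * odd_tent N i t)"

text \<open>The radial projection of s0 + w v to the unit circle, that is, the point at angle arctan
  w. Where the wave vanishes the loop sits at the base point, which takes care of the canonical
  extension.\<close>

definition wave_loop :: "'a::real_inner \<Rightarrow> 'a \<Rightarrow> nat \<Rightarrow> (nat \<Rightarrow> real) \<Rightarrow> real \<Rightarrow> 'a"
  where "wave_loop s0 v N x t = (1 / sqrt (1 + (wave N x t)\<^sup>2)) *\<^sub>R (s0 + wave N x t *\<^sub>R v)"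

lemma wave_node: "j \<le> N \<Longrightarrow> wave N x (tent_node N j) = x j"
  by (simp add: wave_def odd_tent_node if_distrib cong: if_cong)

text \<open>Reflection in 1/2 negates the wave, and so does negating all its coefficients.\<close>

lemma rev_wave_loop: "rev_loop (wave_loop s0 v N x) = wave_loop s0 v N (antipode x)"
  by (simp add: rev_loop_def wave_loop_def wave_def odd_tent_reflect antipode_def sum_negf fun_eq_iff)

lemma continuous_on_wave_loop: "continuous_on S (\<lambda>(x, t). wave_loop s0 v N x t)"
proof -
  have "continuous_on S (\<lambda>p. fst p i)" for i :: nat and S :: "((nat \<Rightarrow> real) \<times> real) set"
    by (rule continuous_on_product_then_coordinatewise) (intro continuous_intros)
  moreover have "1 + (wave N x t)\<^sup>2 \<noteq> 0" for x t
    by (smt (verit) zero_le_power2)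
  ultimately show ?thesis
    unfolding case_prod_unfold wave_loop_def wave_def
    by (intro continuous_intros continuous_on_odd_tent) (auto simp: wave_def)
qed

section \<open>The equivariant embedding of spheres into the loop space\<close>

context
  fixes s0 v :: "'a::euclidean_space"
  assumes s0: "norm s0 = 1" and v: "norm v = 1" and orth: "s0 \<bullet> v = 0"
begin

lemma wave_loop_in_loops: "wave_loop s0 v N x \<in> loops s0"
proof -
  have "norm (wave_loop s0 v N x t) = 1" for t
  proof -
    let ?w = "wave N x t"
    have "(norm (s0 + ?w *\<^sub>R v))\<^sup>2 = 1 + ?w\<^sup>2"
      using s0 v orth unfolding power2_norm_eq_inner norm_eq_1
      by (simp add: inner_add_left inner_add_right inner_commute [of v s0] power2_eq_square)
    then have "norm (s0 + ?w *\<^sub>R v) = sqrt (1 + ?w\<^sup>2)"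
      by (metis norm_ge_zero real_sqrt_unique)
    moreover have "sqrt (1 + ?w\<^sup>2) > 0"
      by (smt (verit) real_sqrt_gt_zero zero_le_power2)
    ultimately show ?thesis
      by (simp add: wave_loop_def)
  qed
  moreover have "wave_loop s0 v N x t = s0" if "t \<le> 0 \<or> 1 \<le> t" for t
    using that by (simp add: wave_loop_def wave_def odd_tent_outside)
  moreover have "continuous_on {0..1} (wave_loop s0 v N x)"
  proof -
    have "continuous_on {0..1} ((\<lambda>(x, t). wave_loop s0 v N x t) \<circ> Pair x)"
      by (intro continuous_on_compose continuous_on_wave_loop continuous_intros)
    then show ?thesis
      by (simp add: o_def)
  qed
  ultimately show ?thesis
    by (auto simp: loops_def)
qed

lemma continuous_map_wave_loop: "continuous_map (top_of_set S) (loop_top s0) (wave_loop s0 v N)"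
  by (intro continuous_map_into_loop_top continuous_on_wave_loop wave_loop_in_loops)

text \<open>Evaluation at the nodes recovers \<open>x\<close>, as u / sqrt (1 + u^2) is an injective
  function of u. It is also odd, so it tells \<open>x\<close> from its antipode.\<close>

lemma wave_loop_node:
  assumes "j \<le> N"
  shows "wave_loop s0 v N x (tent_node N j) \<bullet> v = x j / sqrt (1 + (x j)\<^sup>2)"
  using assms v orth by (simp add: wave_loop_def wave_node inner_add_left norm_eq_1)

lemma wave_loop_notin_tf_loops:
  assumes "x \<in> topspace (nsphere N)"
  shows "wave_loop s0 v N x \<notin> tf_loops s0"
proof
  assume "wave_loop s0 v N x \<in> tf_loops s0"
  then have eq: "wave_loop s0 v N x = wave_loop s0 v N (antipode x)"
    by (simp add: tf_loops_def rev_wave_loop)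
  have "x j = 0" if "j \<le> N" for j
  proof -
    have "x j / sqrt (1 + (x j)\<^sup>2) = - x j / sqrt (1 + (x j)\<^sup>2)"
      using wave_loop_node [OF that, of x] wave_loop_node [OF that, of "antipode x"] eq
      by (simp add: antipode_def)
    moreover have "sqrt (1 + (x j)\<^sup>2) \<noteq> 0"
      by (smt (verit) real_sqrt_gt_zero zero_le_power2)
    ultimately show ?thesis
      by (simp add: field_simps)
  qed
  then show False
    using assms by (simp add: nsphere)
qed

end


section \<open>The coincidence set\<close>

text \<open>A finite open cover of the coincidence set is chosen so that the preimage in the sphere
  of each member contains no antipodal pair. A refinement of order d + 1 inherits this, and its
  preimages contradict \<open>antipodal_cover_of_zero_set\<close>.\<close>

lemma not_covering_dim_le_coincidence_set:
  fixes s0 :: "'a::euclidean_space" and f :: "(real \<Rightarrow> 'a) \<Rightarrow> 'b::euclidean_space"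
  assumes s0: "norm s0 = 1" and dim: "2 \<le> DIM('a)"
    and f: "continuous_map (subtopology (loop_top s0) (loops s0 - tf_loops s0)) euclidean f"
  shows "\<not> covering_dim_le (subtopology (loop_top s0) (coincidence_set s0 f)) d"
proof
  define A where "A = coincidence_set s0 f"
  define X where "X = subtopology (loop_top s0) A"
  assume "covering_dim_le (subtopology (loop_top s0) (coincidence_set s0 f)) d"
  then have dimX: "covering_dim_le X d"
    by (simp add: X_def A_def)
  have topX: "topspace X = A"
    by (auto simp: X_def topspace_loop_top A_def coincidence_set_def)
  obtain y where y: "y \<noteq> 0" "orthogonal s0 y"
    using orthogonal_to_vector_exists [OF dim] by blast
  define v where "v = y /\<^sub>R norm y"
  have v: "norm v = 1" "s0 \<bullet> v = 0"
    using y by (simp_all add: v_def orthogonal_def)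
  define k where "k = DIM('b)"
  define N where "N = k + 2 * (d + 1)"
  let ?S = "topspace (nsphere N)"
  define \<alpha> where "\<alpha> = wave_loop s0 v N"
  obtain b :: "nat \<Rightarrow> 'b" where "bij_betw b {0..<k} Basis"
    unfolding k_def using ex_bij_betw_nat_finite [OF finite_Basis] by blast
  then have b: "b ` {..<k} = Basis"
    by (simp add: bij_betw_def atLeast0LessThan)
  \<comment> \<open>As \<alpha> turns the antipode into loop reversal, these are the coordinates of
    the difference that vanishes on the coincidence set.\<close>
  define F where "F = (\<lambda>i x. (f (\<alpha> x) - f (\<alpha> (antipode x))) \<bullet> b i)"
  define Z where "Z = {x \<in> ?S. \<forall>i<k. F i x = 0}"
  have \<alpha>_free: "\<alpha> x \<in> loops s0 - tf_loops s0" if "x \<in> ?S" for x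
    using wave_loop_in_loops [OF s0 v] wave_loop_notin_tf_loops [OF s0 v that] by (simp add: \<alpha>_def)
  have ZA: "x \<in> Z \<longleftrightarrow> \<alpha> x \<in> A" if "x \<in> ?S" for x
  proof -
    have "(\<forall>i<k. F i x = 0) \<longleftrightarrow> (\<forall>u\<in>b ` {..<k}. (f (\<alpha> x) - f (\<alpha> (antipode x))) \<bullet> u = 0)"
      by (auto simp: F_def)
    also have "\<dots> \<longleftrightarrow> f (\<alpha> x) = f (\<alpha> (antipode x))"
      unfolding b by (metis eq_iff_diff_eq_0 euclidean_all_zero_iff)
    finally show ?thesis
      using that \<alpha>_free [OF that] by (auto simp: Z_def A_def coincidence_set_def \<alpha>_def rev_wave_loop)
  qed
  have contf: "continuous_on ?S (\<lambda>x. f (\<alpha> x))"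
  proof -
    have "continuous_map (top_of_set ?S) (subtopology (loop_top s0) (loops s0 - tf_loops s0)) \<alpha>"
      using \<alpha>_free continuous_map_wave_loop [OF s0 v]
      by (auto simp: continuous_map_in_subtopology \<alpha>_def)
    then have "continuous_map (top_of_set ?S) euclidean (f \<circ> \<alpha>)"
      using f by (rule continuous_map_compose)
    then show ?thesis
      by (simp add: o_def)
  qed
  have contF: "continuous_on ?S (F i)" for i
    unfolding F_def
    by (intro continuous_intros contf continuous_on_compose2 [OF contf continuous_on_antipode])
      (auto simp: antipode_in_topspace_nsphere)
  \<comment> \<open>A substitute for the coordinates of the sphere that makes sense for every loop,
    so that the cover can be defined on the whole coincidence set.\<close>
  define ev where "ev = (\<lambda>j \<beta>. \<beta> (tent_node N j) \<bullet> v)"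
  have node01: "tent_node N j \<in> {0..1}" if "j \<le> N" for j
    using tent_node_bounds [OF that] by auto
  have cev: "continuous_map X euclideanreal (ev j)" if "j \<le> N" for j
  proof -
    have "continuous_map X euclidean (\<lambda>\<beta>. \<beta> (tent_node N j))"
      unfolding X_def using continuous_map_loop_eval [OF node01 [OF that]] by (rule continuous_map_from_subtopology)
    moreover have "continuous_map euclidean euclideanreal (\<lambda>y. y \<bullet> v)"
      by (auto intro!: continuous_intros)
    ultimately have "continuous_map X euclideanreal ((\<lambda>y. y \<bullet> v) \<circ> (\<lambda>\<beta>. \<beta> (tent_node N j)))"
      by (rule continuous_map_compose)
    then show ?thesis
      by (simp add: ev_def o_def)
  qed
  have ev\<alpha>: "ev j (\<alpha> x) = x j / sqrt (1 + (x j)\<^sup>2)" if "j \<le> N" for j x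
    using wave_loop_node [OF s0 v that] by (simp add: ev_def \<alpha>_def)
  define Up where "Up = (\<lambda>j. {\<beta> \<in> topspace X. ev j \<beta> \<in> {0<..}})"
  define Um where "Um = (\<lambda>j. {\<beta> \<in> topspace X. ev j \<beta> \<in> {..<0}})"
  \<comment> \<open>\<open>A\<close> is not compact, so the half-spaces alone need not cover it; \<open>W\<close> contains the rest and
    misses the embedded sphere.\<close>
  define W where "W = {\<beta> \<in> topspace X. (\<Sum>j\<le>N. (ev j \<beta>)\<^sup>2) \<in> {..<1 / 2}}"
  define \<U> where "\<U> = Up ` {..N} \<union> Um ` {..N} \<union> {W}"
  have "finite \<U>"
    by (simp add: \<U>_def)
  moreover have "openin X U" if "U \<in> \<U>" for U
  proof -
    have "openin X (Up j)" "openin X (Um j)" if "j \<le> N" for j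
      unfolding Up_def Um_def by (intro openin_continuous_map_preimage [OF cev [OF that]]; simp)+
    moreover have "openin X W"
    proof -
      have "continuous_map X euclideanreal (\<lambda>\<beta>. \<Sum>j\<le>N. (ev j \<beta>)\<^sup>2)"
        by (intro continuous_intros cev) auto
      then show ?thesis
        unfolding W_def by (rule openin_continuous_map_preimage) simp
    qed
    ultimately show ?thesis
      using that by (auto simp: \<U>_def)
  qed
  moreover have "\<Union>\<U> = topspace X"
  proof
    show "\<Union>\<U> \<subseteq> topspace X"
      by (auto simp: \<U>_def Up_def Um_def W_def)
    show "topspace X \<subseteq> \<Union>\<U>"
    proof
      fix \<beta> assume \<beta>: "\<beta> \<in> topspace X"
      show "\<beta> \<in> \<Union>\<U>"
      proof (cases "\<forall>j\<le>N. ev j \<beta> = 0")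
        case True
        then have "\<beta> \<in> W"
          using \<beta> by (simp add: W_def)
        then show ?thesis
          by (simp add: \<U>_def)
      next
        case False
        then obtain j where "j \<le> N" "ev j \<beta> > 0 \<or> ev j \<beta> < 0"
          by (meson linorder_neqE_linordered_idom)
        then have "\<beta> \<in> Up j \<union> Um j"
          using \<beta> by (auto simp: Up_def Um_def)
        then show ?thesis
          using \<open>j \<le> N\<close> by (auto simp: \<U>_def)
      qed
    qed
  qed
  ultimately have \<U>: "finite \<U> \<and> (\<forall>U\<in>\<U>. openin X U) \<and> \<Union>\<U> = topspace X"
    by simp
  obtain \<V> where fin: "finite \<V>" and ope: "\<forall>V\<in>\<V>. openin X V" and cov: "\<Union>\<V> = topspace X"
    and ref: "\<forall>V\<in>\<V>. \<exists>U\<in>\<U>. V \<subseteq> U" and ord: "\<forall>\<beta>\<in>topspace X. card {V \<in> \<V>. \<beta> \<in> V} \<le> d + 1"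
    using dimX [unfolded covering_dim_le_def, THEN spec, THEN mp, OF \<U>] by (elim exE conjE)
  define P where "P = (\<lambda>V. {x \<in> Z. \<alpha> x \<in> V})"
  have ZS: "Z \<subseteq> ?S"
    by (auto simp: Z_def)
  show False
  proof (rule antipodal_cover_of_zero_set [where F = F and k = k and d = d and P = P, OF _ _ fin, folded N_def, folded Z_def])
    show "continuous_on ?S (F i)" for i
      by (rule contF)
    show "F i (antipode x) = - F i x" for i x
      by (simp add: F_def inner_diff_left)
    show "openin (top_of_set Z) (P V)" if "V \<in> \<V>" for V
    proof -
      have "continuous_map (top_of_set Z) X \<alpha>"
        unfolding X_def continuous_map_in_subtopology
        using continuous_map_wave_loop [OF s0 v] ZA ZS by (auto simp: \<alpha>_def)
      then have "openin (top_of_set Z) {x \<in> topspace (top_of_set Z). \<alpha> x \<in> V}"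
        using ope that by (intro openin_continuous_map_preimage) auto
      then show ?thesis
        by (simp add: P_def)
    qed
    show "Z \<subseteq> (\<Union>V\<in>\<V>. P V)"
      using ZA ZS cov topX by (fastforce simp: P_def)
    show "card {V \<in> \<V>. x \<in> P V} \<le> d + 1" if "x \<in> Z" for x
      using ord that ZA ZS topX by (auto simp: P_def)
    show "antipode x \<notin> P V" if "V \<in> \<V>" "x \<in> P V" for V x
    proof
      assume ax: "antipode x \<in> P V"
      have xS: "x \<in> ?S"
        using that ZS by (auto simp: P_def)
      obtain U where "U \<in> \<U>" "V \<subseteq> U"
        using ref \<open>V \<in> \<V>\<close> by blast
      then have U: "\<alpha> x \<in> U" "\<alpha> (antipode x) \<in> U"
        using that ax by (auto simp: P_def)
      have ev_anti: "ev j (\<alpha> (antipode x)) = - ev j (\<alpha> x)" if "j \<le> N" for j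
        using that by (simp add: ev\<alpha> antipode_def)
      \<comment> \<open>This fixes the bound 1/2 in \<open>W\<close>: each (x j)^2 is at most 1, so
        dividing by 1 + (x j)^2 at most halves it, and the squares sum to 1.\<close>
      have "(\<Sum>j\<le>N. (ev j (\<alpha> x))\<^sup>2) \<ge> 1 / 2"
      proof -
        have "(x j)\<^sup>2 / 2 \<le> (ev j (\<alpha> x))\<^sup>2" if "j \<le> N" for j
        proof -
          have "(x j)\<^sup>2 / 2 \<le> (x j)\<^sup>2 / (1 + (x j)\<^sup>2)"
            using topspace_nsphere_1 [OF xS, of j] by (intro divide_left_mono) (auto intro: add_pos_nonneg)
          then show ?thesis
            using that by (simp add: ev\<alpha> power_divide)
        qed
        then have "(\<Sum>j\<le>N. (x j)\<^sup>2 / 2) \<le> (\<Sum>j\<le>N. (ev j (\<alpha> x))\<^sup>2)"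
          by (intro sum_mono) simp
        moreover have "(\<Sum>j\<le>N. (x j)\<^sup>2) = 1"
          using xS by (simp add: nsphere)
        ultimately show ?thesis
          by (simp flip: sum_divide_distrib)
      qed
      then have "U \<noteq> W"
        using U by (auto simp: W_def)
      then obtain j where "j \<le> N" "U = Up j \<or> U = Um j"
        using \<open>U \<in> \<U>\<close> by (auto simp: \<U>_def)
      then show False
        using U ev_anti by (auto simp: Up_def Um_def)
    qed
  qed
qed

theorem theorem1:
  fixes s0 :: "'a::euclidean_space"
  assumes "s0 \<in> sphere 0 1"
    and "DIM('a) \<ge> 2"
  shows "(DIM('b::euclidean_space) < DIM('a) - 1 \<longrightarrow>
           (\<forall>f :: (real \<Rightarrow> 'a) \<Rightarrow> 'b.
              continuous_map (subtopology (loop_top s0) (loops s0 - tf_loops s0)) euclidean f \<longrightarrow>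
              infinite_dim (subtopology (loop_top s0) (coincidence_set s0 f))))
       \<and> (DIM('b) = DIM('a) - 1 \<longrightarrow>
           (\<forall>f :: (real \<Rightarrow> 'a) \<Rightarrow> 'b.
              continuous_map (subtopology (loop_top s0) (loops s0 - tf_loops s0)) euclidean f \<longrightarrow>
              coincidence_set s0 f \<noteq> {}))"
proof -
  have inf: "infinite_dim (subtopology (loop_top s0) (coincidence_set s0 f))"
    if "continuous_map (subtopology (loop_top s0) (loops s0 - tf_loops s0)) euclidean f"
    for f :: "(real \<Rightarrow> 'a) \<Rightarrow> 'b"
    using not_covering_dim_le_coincidence_set [OF _ assms(2) that] assms(1) by (simp add: infinite_dim_def)
  \<comment> \<open>The empty space satisfies every dimension bound, so infinite dimension forces a
    coincidence.\<close>
  have "\<not> infinite_dim (subtopology (loop_top s0) {})"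
    by (auto simp: infinite_dim_def covering_dim_le_def)
  with inf show ?thesis
    by metis
qed

end
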